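(* Let $\lambda>0$, $\kappa\in(0,1)$, and let $X$ be a $\mathrm{PDS}(\gamma,\lambda,\kappa)$ random variable with $\gamma=1$. Then for every integer $m\ge1$ $$\mathbb{P}(X=m)=e^{-\lambda}\sum_{s=0}^{m-1}\frac{\lambda^{s+1}}{(s+1)!}\binom{m-1}{s}\kappa^{m-s-1}(1-\kappa)^{s+1}.$$
   Context: For $\gamma\in(0,1]$, $\lambda>0$, $\kappa\in[0,1)$, $\mathrm{PDS}(\gamma,\lambda,\kappa)$ denotes the distribution on $\mathbb{N}_0$ with probability generating function $\mathrm{E}z^X=\exp\left\{-\lambda\left(\frac{1-z}{1-\kappa z}\right)^{\gamma}\right\}$. *)

theory Defs
  imports "HOL-Probability.Probability"
begin

(* The law on nat is unique, as the probability generating function determines it, so it is given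
   here by its defining property.
   For real z with |z| <= 1 the base (1 - z) / (1 - kappa * z) is nonnegative; at z = 1 the
   convention 0 powr gamma = 0 gives the expected value E 1^X = exp 0 = 1. *)
definition is_PDS :: "real \<Rightarrow> real \<Rightarrow> real \<Rightarrow> nat measure \<Rightarrow> bool" where
  "is_PDS \<gamma> lam \<kappa> \<mu> \<longleftrightarrow>
     0 < \<gamma> \<and> \<gamma> \<le> 1 \<and> 0 < lam \<and> 0 \<le> \<kappa> \<and> \<kappa> < 1 \<and>
     prob_space \<mu> \<and> sets \<mu> = sets (count_space UNIV) \<and>
     (\<forall>z::real. \<bar>z\<bar> \<le> 1 \<longrightarrow>
        (LINT x|\<mu>. z ^ x) = exp (- lam * ((1 - z) / (1 - \<kappa> * z)) powr \<gamma>))"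

end

theory Submission
  imports Defs "HOL-Complex_Analysis.Complex_Analysis"
begin

text \<open>
  For \<open>\<gamma> = 1\<close> the generating function is that of a compound Poisson law with geometric jumps, because
  \<open>(1 - z) / (1 - \<kappa> z) = 1 - (1 - \<kappa>) z / (1 - \<kappa> z)\<close> turns it into
  \<open>exp (- lam) * exp (c z / (1 - \<kappa> z))\<close> with \<open>c = lam (1 - \<kappa>)\<close>. The \<open>i\<close>-th term of the outer
  exponential series is \<open>c ^ i / i!\<close> times \<open>z ^ i / (1 - \<kappa> z) ^ i\<close>, whose coefficients are given by
  the negative binomial series. Only the terms with \<open>1 \<le> i \<le> m\<close> contribute to \<open>z ^ m\<close>, which is the
  claimed finite sum with \<open>i = s + 1\<close> (lemma \<open>fps_exp_compose_geometric_nth\<close>).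

  The composition of formal power series keeps the rearrangement of the double series purely
  algebraic. What remains is to compare coefficients. The generating function is known on the real
  axis only, whereas the convergence of the composed series comes from holomorphy. Both sides are
  therefore read as complex power series; when convergent, these are determined by their values at small
  positive reals (lemma \<open>complex_fps_eqI_pos_reals\<close>).
\<close>

lemma fps_exp_compose_geometric_nth:
  fixes c k :: "'a :: field_char_0"
  assumes "1 \<le> m"
  shows "fps_nth (fps_compose (fps_exp 1)
           (fps_const c * (fps_X * inverse (1 - fps_const k * fps_X)))) m =
         (\<Sum>s = 0..m - 1. c ^ (s + 1) / fact (s + 1) * of_nat ((m - 1) choose s) * k ^ (m - s - 1))"
proof -
  define G where "G = fps_const c * (fps_X * inverse (1 - fps_const k * fps_X))"
  obtain n where m: "m = Suc n"
    using assms by (cases m) auto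
  have pow: "fps_nth (G ^ Suc s) m = c ^ Suc s * (of_nat (n choose s) * k ^ (n - s))"
    if "s \<le> n" for s
  proof -
    have "G ^ Suc s = fps_const (c ^ Suc s) *
        (fps_X ^ Suc s * inverse ((1 - fps_const k * fps_X) ^ Suc s))"
      by (simp only: G_def power_mult_distrib fps_const_power fps_inverse_power)
    also have "inverse ((1 - fps_const k * fps_X) ^ Suc s) =
        Abs_fps (\<lambda>j. of_nat ((Suc s + j - 1) choose j) * k ^ j)"
      by (rule one_minus_const_fps_X_neg_power') simp
    finally have "fps_nth (G ^ Suc s) m =
        c ^ Suc s * (of_nat (n choose (n - s)) * k ^ (n - s))"
      using that by (simp only: fps_mult_left_const_nth fps_X_power_mult_nth m) simp
    then show ?thesis
      using that by (simp add: binomial_symmetric[of s n])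
  qed
  have "fps_nth (fps_compose (fps_exp 1) G) m = (\<Sum>i = 0..Suc n. fps_nth (G ^ i) m / fact i)"
    by (simp add: fps_compose_nth m)
  also have "\<dots> = (\<Sum>s = 0..n. fps_nth (G ^ Suc s) m / fact (Suc s))"
    by (subst sum.atLeast0_atMost_Suc_shift) (simp add: m)
  also have "\<dots> = (\<Sum>s = 0..n. c ^ (s + 1) / fact (s + 1) * of_nat (n choose s) * k ^ (n - s))"
    by (intro sum.cong refl) (simp only: pow atLeastAtMost_iff, simp)
  finally show ?thesis
    by (simp add: G_def m)
qed

text \<open>
  A nonzero convergent power series does not vanish on a small enough punctured disc around the
  origin, and every such disc contains positive reals.
\<close>

lemma complex_fps_eqI_pos_reals:
  fixes F G :: "complex fps"
  assumes F: "fps_conv_radius F > 0" and G: "fps_conv_radius G > 0"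
    and eq: "eventually (\<lambda>x. eval_fps F (of_real x) = eval_fps G (of_real x)) (at_right (0::real))"
  shows "F = G"
proof (rule ccontr)
  assume "F \<noteq> G"
  have "(\<lambda>z. eval_fps F z - eval_fps G z) has_fps_expansion F - G"
    using F G by (intro has_fps_expansion_diff eval_fps_has_fps_expansion)
  then have "(\<lambda>z. eval_fps F z - eval_fps G z) has_laurent_expansion fps_to_fls (F - G)"
    by (rule has_laurent_expansion_fps)
  then have "eventually (\<lambda>z. eval_fps F z - eval_fps G z \<noteq> 0) (at 0)"
    using \<open>F \<noteq> G\<close> by (subst has_laurent_expansion_eventually_nonzero_iff') auto
  moreover have "filterlim complex_of_real (at 0) (at_right 0)"
    by (rule filterlim_atI) (auto intro!: tendsto_eq_intros simp: eventually_at_filter)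
  ultimately have "eventually (\<lambda>x. eval_fps F (of_real x) - eval_fps G (of_real x) \<noteq> 0)
      (at_right (0::real))"
    by (rule eventually_compose_filterlim)
  with eq have "eventually (\<lambda>x::real. False) (at_right 0)"
    by eventually_elim simp
  then show False
    by simp
qed

lemma pgf_sums:
  fixes \<mu> :: "nat measure" and z :: real
  assumes "prob_space \<mu>" and sets: "sets \<mu> = sets (count_space UNIV)" and z: "\<bar>z\<bar> \<le> 1"
  shows "(\<lambda>n. measure \<mu> {n} * z ^ n) sums (LINT x|\<mu>. z ^ x)"
proof -
  interpret prob_space \<mu> by fact
  have sp: "space \<mu> = UNIV"
    using sets_eq_imp_space_eq[OF sets] by simp
  have sets_all [simp]: "A \<in> sets \<mu>" for A
    by (simp add: sets)
  let ?f = "\<lambda>n x. indicator {n} x * z ^ n :: real"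
  have int: "integrable \<mu> (?f n)" for n
    by (intro integrable_mult_left integrable_real_indicator) (auto simp: emeasure_eq_measure)
  have norm_le: "norm (z ^ n) \<le> 1" for n
    using z by (simp add: power_abs power_le_one)
  \<comment> \<open>Absolute convergence for every such \<open>z\<close> follows by comparison with \<open>z = 1\<close>.\<close>
  have total: "(\<lambda>n. measure \<mu> {n}) sums 1"
    using finite_measure_UNION[of "\<lambda>n. {n}"] prob_space
    by (simp add: disjoint_family_on_def sp image_subset_iff)
  have "(\<lambda>n. integral\<^sup>L \<mu> (?f n)) sums (LINT x|\<mu>. (\<Sum>n. ?f n x))"
  proof (rule sums_integral)
    show "AE x in \<mu>. summable (\<lambda>n. norm (?f n x))"
    proof (rule AE_I2)
      fix x :: nat
      show "summable (\<lambda>n. norm (?f n x))"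
        by (rule summable_finite[of "{x}"]) auto
    qed
    have "(LINT x|\<mu>. norm (?f n x)) = measure \<mu> {n} * norm (z ^ n)" for n
      by (simp add: abs_mult sp)
    then show "summable (\<lambda>n. LINT x|\<mu>. norm (?f n x))"
      using norm_le by (intro summable_comparison_test'[OF sums_summable[OF total], of 0])
        (auto simp: mult_left_le)
  qed (rule int)
  moreover have "(\<Sum>n. ?f n x) = z ^ x" for x
    by (subst suminf_finite[of "{x}"]) auto
  moreover have "integral\<^sup>L \<mu> (?f n) = measure \<mu> {n} * z ^ n" for n
    by (simp add: sp)
  ultimately show ?thesis
    by simp
qed

text \<open>
  This is how a closed form of a generating function yields the point masses: the closed form \<open>h\<close>
  may be any complex function with a power series expansion, so that the closure rules for
  expansions compute \<open>H\<close>, while the law is consulted only at real arguments.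
\<close>

lemma fps_nth_closed_form_pgf:
  fixes \<mu> :: "nat measure" and H :: "complex fps" and h :: "complex \<Rightarrow> complex"
  assumes \<mu>: "prob_space \<mu>" "sets \<mu> = sets (count_space UNIV)"
    and h: "h has_fps_expansion H"
    and pgf: "\<And>x. 0 < x \<Longrightarrow> x < 1 \<Longrightarrow> h (of_real x) = of_real (LINT n|\<mu>. x ^ n)"
  shows "fps_nth H n = of_real (measure \<mu> {n})"
proof -
  define F where "F = Abs_fps (\<lambda>n. complex_of_real (measure \<mu> {n}))"
  have sums: "(\<lambda>n. fps_nth F n * of_real x ^ n) sums of_real (LINT n|\<mu>. x ^ n)"
    if "0 < x" "x < 1" for x :: real
    using sums_of_real[OF pgf_sums[OF \<mu>, of x], where ?'a = complex] that by (simp add: F_def)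
  have "fps_conv_radius F \<ge> norm (complex_of_real (1 / 2))"
    unfolding fps_conv_radius_def
    by (rule conv_radius_geI, rule sums_summable, rule sums) auto
  then have F: "fps_conv_radius F > 0"
    by (rule less_le_trans[rotated]) (simp add: zero_ereal_def)
  have "filterlim (\<lambda>x::real. complex_of_real x) (nhds 0) (at_right 0)"
    by (auto intro!: tendsto_eq_intros)
  moreover have "eventually (\<lambda>z. eval_fps H z = h z) (nhds 0)"
    using h by (simp add: has_fps_expansion_def)
  ultimately have "eventually (\<lambda>x::real. eval_fps H (of_real x) = h (of_real x)) (at_right 0)"
    by (rule eventually_compose_filterlim[rotated])
  moreover have "eventually (\<lambda>x::real. 0 < x \<and> x < 1) (at_right 0)"
    by (rule eventually_at_rightI[of _ 1]) auto
  ultimately have "eventually (\<lambda>x. eval_fps F (of_real x) = eval_fps H (of_real x)) (at_right 0)"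
  proof eventually_elim
    case (elim x)
    then have "eval_fps F (of_real x) = of_real (LINT n|\<mu>. x ^ n)"
      using sums[of x] by (simp add: eval_fps_def sums_iff)
    with elim show ?case
      by (simp add: pgf)
  qed
  then have "F = H"
    using F h by (intro complex_fps_eqI_pos_reals) (auto simp: has_fps_expansion_def)
  then show ?thesis
    by (auto simp: F_def)
qed

theorem theorem3p8:
  fixes M :: "'a measure" and X :: "'a \<Rightarrow> nat" and lam \<kappa> :: real and m :: nat
  assumes "prob_space M"
    and "X \<in> measurable M (count_space UNIV)"
    and "0 < lam" and "0 < \<kappa>" and "\<kappa> < 1"
    and "is_PDS 1 lam \<kappa> (distr M (count_space UNIV) X)"
    and "1 \<le> m"
  shows "\<P>(\<omega> in M. X \<omega> = m) =
    exp (- lam) * (\<Sum>s = 0..m - 1. lam ^ (s + 1) / fact (s + 1) *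
      real ((m - 1) choose s) * \<kappa> ^ (m - s - 1) * (1 - \<kappa>) ^ (s + 1))"
proof -
  define \<mu> where "\<mu> = distr M (count_space UNIV) X"
  define c where "c = lam * (1 - \<kappa>)"
  define G :: "complex fps"
    where "G = fps_const (of_real c) * (fps_X * inverse (1 - fps_const (of_real \<kappa>) * fps_X))"
  define g :: "complex \<Rightarrow> complex"
    where "g = (\<lambda>z. of_real c * (z * inverse (1 - of_real \<kappa> * z)))"
  define h :: "complex \<Rightarrow> complex" where "h = (\<lambda>z. of_real (exp (- lam)) * (exp \<circ> g) z)"
  define H where "H = fps_const (of_real (exp (- lam))) * fps_compose (fps_exp 1) G"
  have PDS: "is_PDS 1 lam \<kappa> \<mu>"
    using assms by (simp add: \<mu>_def)
  have "g has_fps_expansion G"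
    unfolding g_def G_def by (intro fps_expansion_intros) auto
  then have h: "h has_fps_expansion H"
    unfolding h_def H_def
    by (intro has_fps_expansion_cmult_left has_fps_expansion_compose has_fps_expansion_exp1)
       (auto simp: G_def)
  have pgf: "h (of_real x) = of_real (LINT n|\<mu>. x ^ n)" if x: "0 < x" "x < 1" for x :: real
  proof -
    have "\<kappa> * x < 1"
      using mult_strict_mono[of \<kappa> 1 x 1] assms x by simp
    then have base: "- lam * ((1 - x) / (1 - \<kappa> * x)) = - lam + c * (x * inverse (1 - \<kappa> * x))"
      by (simp add: c_def field_simps)
    have "(1 - x) / (1 - \<kappa> * x) \<ge> 0"
      using x \<open>\<kappa> * x < 1\<close> by simp
    then have "(LINT n|\<mu>. x ^ n) = exp (- lam * ((1 - x) / (1 - \<kappa> * x)))"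
      using PDS x \<open>\<kappa> * x < 1\<close> by (simp add: is_PDS_def)
    also have "\<dots> = exp (- lam) * exp (c * (x * inverse (1 - \<kappa> * x)))"
      by (simp only: base exp_add)
    finally show ?thesis
      by (simp add: h_def g_def flip: exp_of_real)
  qed
  have "complex_of_real (measure \<mu> {m}) = fps_nth H m"
    using fps_nth_closed_form_pgf[OF _ _ h pgf] PDS by (simp add: is_PDS_def)
  also have "\<dots> = of_real (exp (- lam) * (\<Sum>s = 0..m - 1. c ^ (s + 1) / fact (s + 1) *
      real ((m - 1) choose s) * \<kappa> ^ (m - s - 1)))"
    unfolding H_def G_def fps_mult_left_const_nth fps_exp_compose_geometric_nth[OF \<open>1 \<le> m\<close>]
    by simp
  finally have "measure \<mu> {m} = exp (- lam) * (\<Sum>s = 0..m - 1. c ^ (s + 1) / fact (s + 1) *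
      real ((m - 1) choose s) * \<kappa> ^ (m - s - 1))"
    by (simp only: of_real_eq_iff)
  moreover have "\<P>(\<omega> in M. X \<omega> = m) = measure \<mu> {m}"
    unfolding \<mu>_def using assms by (subst measure_distr) (auto intro!: arg_cong[of _ _ "measure M"])
  ultimately show ?thesis
    by (simp add: c_def power_mult_distrib mult_ac)
qed

end
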